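(* Let $E:=\{(x,y,z)\in\mathbb{R}^3 : x,y,z>0\}$, fix a real number $\alpha>0$, and define $u:E\to\mathbb{R}$ by $$u(x,y,z)=\frac{z^{\alpha}(x^{\alpha}+y^{\alpha})}{x^{\alpha}y^{\alpha}}.$$ Then $E$ is convex and $u$ is quasi-convex in $E$. Moreover, if $\alpha\in(0,1]$, then for any $(x_0,y_0,z_0)\in E$ and any twice continuously differentiable function $F:\mathbb{R}\to\mathbb{R}$ such that $F'(u(x_0,y_0,z_0))\neq 0$, the ($3\times 3$) matrix of second-order derivatives of the function $(x,y,z)\mapsto F(u(x,y,z))$ at $(x_0,y_0,z_0)$ is neither nonnegative nor nonpositive. Hence (for $\alpha\in(0,1]$ and $F:\mathbb{R}\to\mathbb{R}$ twice continuously differentiable), if $F'>0$ on $\mathbb{R}$ or $F'<0$ on $\mathbb{R}$, then $F(u(x,y,z))$ is neither convex nor concave in any neighborhood of any point in $E$.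
   Context: A real-valued function $u$ defined on a convex subset $E$ of $\mathbb{R}^d$ is called quasi-convex if $u(\lambda p+(1-\lambda)q)\le \max[u(p),u(q)]$ for all $\lambda\in[0,1]$ and $p,q\in E$. A function $f$ is convex if $f(\lambda p+(1-\lambda)q)\le \lambda f(p)+(1-\lambda)f(q)$ for all such $\lambda,p,q$, and concave if $-f$ is convex. A symmetric matrix $A$ is called nonnegative (respectively nonpositive) if $\langle \eta, A\eta\rangle\ge 0$ (respectively $\le 0$) for all vectors $\eta$, i.e. if it is positive (respectively negative) semidefinite. *)

theory Defs
  imports "HOL-Analysis.Analysis"
begin

definition pos_octant :: "(real ^ 3) set" where
  "pos_octant = {p. 0 < p $ 1 \<and> 0 < p $ 2 \<and> 0 < p $ 3}"

definition ratio_fun :: "real \<Rightarrow> real ^ 3 \<Rightarrow> real" where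
  "ratio_fun \<alpha> p = ((p $ 3) powr \<alpha> * ((p $ 1) powr \<alpha> + (p $ 2) powr \<alpha>))
                   / ((p $ 1) powr \<alpha> * (p $ 2) powr \<alpha>)"

text \<open>As in \<^const>\<open>convex_on\<close>, convexity of the domain is part of the notion.\<close>

definition quasi_convex_on :: "'a::real_vector set \<Rightarrow> ('a \<Rightarrow> real) \<Rightarrow> bool" where
  "quasi_convex_on S f \<longleftrightarrow> convex S \<and>
     (\<forall>l\<in>{0..1}. \<forall>p\<in>S. \<forall>q\<in>S. f (l *\<^sub>R p + (1 - l) *\<^sub>R q) \<le> max (f p) (f q))"

definition twice_cont_differentiable :: "(real \<Rightarrow> real) \<Rightarrow> bool" where
  "twice_cont_differentiable F \<longleftrightarrow>
     (\<forall>t. F differentiable (at t)) \<and>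
     (\<forall>t. deriv F differentiable (at t)) \<and>
     continuous_on UNIV (deriv (deriv F))"

definition partial_deriv :: "'n \<Rightarrow> (real ^ 'n \<Rightarrow> real) \<Rightarrow> real ^ 'n \<Rightarrow> real" where
  "partial_deriv i f p = deriv (\<lambda>t. f (p + t *\<^sub>R axis i 1)) 0"

text \<open>Since \<^const>\<open>deriv\<close> is total, the entries are meaningful only where the
  second-order partial derivatives exist.\<close>

definition hessian :: "(real ^ 'n \<Rightarrow> real) \<Rightarrow> real ^ 'n \<Rightarrow> real ^ 'n ^ 'n" where
  "hessian f p = (\<chi> i j. partial_deriv i (partial_deriv j f) p)"

text \<open>Symmetry is deliberately not part of the next two predicates: they are used negated,
  and including it would let their negations hold for mere lack of symmetry.\<close>

definition nonnegative_matrix :: "real ^ 'n ^ 'n \<Rightarrow> bool" where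
  "nonnegative_matrix A \<longleftrightarrow> (\<forall>v. 0 \<le> v \<bullet> (A *v v))"

definition nonpositive_matrix :: "real ^ 'n ^ 'n \<Rightarrow> bool" where
  "nonpositive_matrix A \<longleftrightarrow> (\<forall>v. v \<bullet> (A *v v) \<le> 0)"

end

theory Submission
  imports Defs
begin

text \<open>
  Quasi-convexity: \<open>u = (x/z) powr -\<alpha> + (y/z) powr -\<alpha>\<close>, and for a convex combination of two points
  the ratios \<open>x/z\<close> and \<open>y/z\<close> are convex combinations, with common weights proportional to the
  \<open>z\<close>-parts, of those at the two points.  Convexity of \<open>t powr -\<alpha>\<close> then bounds \<open>u\<close> by a weighted
  mean of its two values.

  Everything else comes from homogeneity: \<open>u\<close> is constant along rays from the origin, so the
  Hessian quadratic form of \<open>F \<circ> u\<close> vanishes at the position vector \<open>p\<close>, while its derivative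
  there does not, because the gradient is homogeneous of degree \<open>-1\<close> and nonzero.  So the form
  changes sign near \<open>p\<close>.  The same effect excludes local convexity and concavity.
\<close>

section \<open>Convexity of the octant and quasi-convexity\<close>

lemma convex_pos_octant: "convex pos_octant"
proof (rule convexI)
  fix p q :: "real ^ 3" and u v :: real
  assume "p \<in> pos_octant" "q \<in> pos_octant" "0 \<le> u" "0 \<le> v" "u + v = 1"
  then show "u *\<^sub>R p + v *\<^sub>R q \<in> pos_octant"
    by (cases "u = 0") (auto simp: pos_octant_def intro!: add_pos_nonneg)
qed

lemma convex_on_powr_neg:
  fixes a :: real
  assumes "0 \<le> a"
  shows "convex_on {0<..} (\<lambda>t. t powr - a)"
proof (rule f''_ge0_imp_convex)
  fix t :: real
  assume t: "t \<in> {0<..}"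
  show "((\<lambda>t. t powr - a) has_real_derivative - a * t powr (- a - 1)) (at t)"
    using t by (auto intro!: derivative_eq_intros)
  show "((\<lambda>t. - a * t powr (- a - 1)) has_real_derivative
      - a * ((- a - 1) * t powr (- a - 1 - 1))) (at t)"
    using t by (auto intro!: derivative_eq_intros)
  have "- a * ((- a - 1) * t powr (- a - 1 - 1)) = a * (a + 1) * t powr (- a - 1 - 1)"
    by (simp add: algebra_simps)
  then show "0 \<le> - a * ((- a - 1) * t powr (- a - 1 - 1))"
    using assms by simp
qed auto

text \<open>Product form for differentiation: each coordinate enters through a single power.\<close>

lemma ratio_fun_eq:
  assumes "p \<in> pos_octant"
  shows "ratio_fun \<alpha> p = (p $ 3) powr \<alpha> * ((p $ 1) powr - \<alpha> + (p $ 2) powr - \<alpha>)"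
  using assms unfolding ratio_fun_def pos_octant_def
  by (simp add: powr_minus field_simps)

text \<open>In this form invariance under scaling is visible, and convexity in one variable applies
  to each summand.\<close>

lemma ratio_fun_eq_ratios:
  assumes "p \<in> pos_octant"
  shows "ratio_fun \<alpha> p = (p $ 1 / p $ 3) powr - \<alpha> + (p $ 2 / p $ 3) powr - \<alpha>"
  using assms unfolding ratio_fun_def pos_octant_def
  by (simp add: powr_minus powr_divide field_simps)

lemma pos_octant_scaleR:
  "p \<in> pos_octant \<Longrightarrow> 0 < r \<Longrightarrow> r *\<^sub>R p \<in> pos_octant"
  by (simp add: pos_octant_def)

lemma ratio_fun_scaleR:
  assumes "p \<in> pos_octant" "0 < r"
  shows "ratio_fun \<alpha> (r *\<^sub>R p) = ratio_fun \<alpha> p"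
  using assms by (simp add: ratio_fun_eq_ratios pos_octant_scaleR)

lemma ratio_fun_pos:
  assumes "p \<in> pos_octant"
  shows "0 < ratio_fun \<alpha> p"
  using assms by (auto simp: ratio_fun_eq pos_octant_def intro!: mult_pos_pos add_pos_pos)

lemma quasi_convex_on_ratio_fun:
  assumes "0 \<le> \<alpha>"
  shows "quasi_convex_on pos_octant (ratio_fun \<alpha>)"
  unfolding quasi_convex_on_def
proof (intro conjI ballI)
  show "convex pos_octant" by (rule convex_pos_octant)
next
  fix l :: real and p q :: "real ^ 3"
  assume l: "l \<in> {0..1}" and p: "p \<in> pos_octant" and q: "q \<in> pos_octant"
  define r where "r = l *\<^sub>R p + (1 - l) *\<^sub>R q"
  have r: "r \<in> pos_octant"
    unfolding r_def using convex_pos_octant p q l by (auto simp: convex_def)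
  have pos: "0 < p $ k" "0 < q $ k" "0 < r $ k" for k
    using p q r exhaust_3[of k] by (auto simp: pos_octant_def)
  \<comment> \<open>The share of \<open>p\<close> in the third coordinate of \<open>r\<close>. It
    does not depend on \<open>k\<close>, so both ratios get the same weights and their estimates can
    be added.\<close>
  define w where "w = l * p $ 3 / r $ 3"
  have w: "0 \<le> w" "1 - w = (1 - l) * q $ 3 / r $ 3"
    using l pos[of 3] by (auto simp: w_def r_def field_simps)
  then have w1: "0 \<le> 1 - w"
    using l pos[of 3] by simp
  have ratio: "(r $ k / r $ 3) powr - \<alpha>
      \<le> w * (p $ k / p $ 3) powr - \<alpha> + (1 - w) * (q $ k / q $ 3) powr - \<alpha>" for k
  proof -
    \<comment> \<open>By the choice of \<open>w\<close>, the factors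
      \<open>w * r $ 3 / p $ 3\<close> and \<open>(1 - w) * r $ 3 / q $ 3\<close> are
      \<open>l\<close> and \<open>1 - l\<close>.\<close>
    have "r $ k = w * r $ 3 * (p $ k / p $ 3) + (1 - w) * r $ 3 * (q $ k / q $ 3)"
      using pos[of 3] unfolding w(2) by (simp add: w_def) (simp add: r_def)
    then have "r $ k / r $ 3 = w * (p $ k / p $ 3) + (1 - w) * (q $ k / q $ 3)"
      using pos[of 3] by (simp add: field_simps)
    then show ?thesis
      \<comment> \<open>\<open>convex_onD\<close> takes the weight of the second point, hence
        \<open>1 - w\<close>.\<close>
      using convex_onD[OF convex_on_powr_neg[OF assms], of "1 - w" "p $ k / p $ 3" "q $ k / q $ 3"]
        w(1) w1 pos[of 3] pos[of k] by simp
  qed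
  have "ratio_fun \<alpha> r \<le> w * ratio_fun \<alpha> p + (1 - w) * ratio_fun \<alpha> q"
    using ratio[of 1] ratio[of 2] unfolding ratio_fun_eq_ratios[OF p]
      ratio_fun_eq_ratios[OF q] ratio_fun_eq_ratios[OF r] by (simp add: algebra_simps)
  also have "\<dots> \<le> max (ratio_fun \<alpha> p) (ratio_fun \<alpha> q)"
    using w(1) w1 by (intro convex_bound_le) auto
  finally show "ratio_fun \<alpha> (l *\<^sub>R p + (1 - l) *\<^sub>R q) \<le> max (ratio_fun \<alpha> p) (ratio_fun \<alpha> q)"
    by (simp add: r_def)
qed

section \<open>Gradient and Hessian of the ratio function\<close>

definition ratio_grad :: "real \<Rightarrow> real ^ 3 \<Rightarrow> real ^ 3" where
  "ratio_grad \<alpha> p = vector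
     [- \<alpha> * (p $ 3) powr \<alpha> * (p $ 1) powr (- \<alpha> - 1),
      - \<alpha> * (p $ 3) powr \<alpha> * (p $ 2) powr (- \<alpha> - 1),
      \<alpha> * (p $ 3) powr (\<alpha> - 1) * ((p $ 1) powr - \<alpha> + (p $ 2) powr - \<alpha>)]"

definition ratio_hess :: "real \<Rightarrow> real ^ 3 \<Rightarrow> real ^ 3 ^ 3" where
  "ratio_hess \<alpha> p = vector
     [vector [\<alpha> * (\<alpha> + 1) * (p $ 3) powr \<alpha> * (p $ 1) powr (- \<alpha> - 2), 0,
        - (\<alpha>\<^sup>2) * (p $ 3) powr (\<alpha> - 1) * (p $ 1) powr (- \<alpha> - 1)],
      vector [0, \<alpha> * (\<alpha> + 1) * (p $ 3) powr \<alpha> * (p $ 2) powr (- \<alpha> - 2),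
        - (\<alpha>\<^sup>2) * (p $ 3) powr (\<alpha> - 1) * (p $ 2) powr (- \<alpha> - 1)],
      vector [- (\<alpha>\<^sup>2) * (p $ 3) powr (\<alpha> - 1) * (p $ 1) powr (- \<alpha> - 1),
        - (\<alpha>\<^sup>2) * (p $ 3) powr (\<alpha> - 1) * (p $ 2) powr (- \<alpha> - 1),
        \<alpha> * (\<alpha> - 1) * (p $ 3) powr (\<alpha> - 2) * ((p $ 1) powr - \<alpha> + (p $ 2) powr - \<alpha>)]]"

text \<open>A derivative at 0 depends only on values near 0, so formulas valid only on the open
  octant may be substituted along a line before differentiating.\<close>

lemma eventually_line_in_open:
  fixes p v :: "'a::real_normed_vector"
  assumes "open S" "p \<in> S"
  shows "\<forall>\<^sub>F t::real in nhds 0. p + t *\<^sub>R v \<in> S"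
proof -
  have "((\<lambda>t::real. p + t *\<^sub>R v) \<longlongrightarrow> p + 0 *\<^sub>R v) (nhds 0)"
    by (intro tendsto_intros filterlim_ident)
  with assms show ?thesis
    by (auto intro: topological_tendstoD)
qed

lemma open_pos_octant: "open pos_octant"
  unfolding pos_octant_def
  by (intro open_Collect_conj open_Collect_less continuous_intros)

lemma has_real_derivative_powr_line:
  fixes x d a :: real
  assumes "0 < x"
  shows "((\<lambda>t. (x + t * d) powr a) has_real_derivative a * x powr (a - 1) * d) (at 0)"
  using assms by (auto intro!: derivative_eq_intros)

lemma has_real_derivative_ratio_fun:
  assumes p: "p \<in> pos_octant"
  shows "((\<lambda>t. ratio_fun \<alpha> (p + t *\<^sub>R v)) has_real_derivative ratio_grad \<alpha> p \<bullet> v) (at 0)"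
proof -
  have pos: "0 < p $ k" for k
    using p exhaust_3[of k] by (auto simp: pos_octant_def)
  have ev: "\<forall>\<^sub>F t in nhds 0. ratio_fun \<alpha> (p + t *\<^sub>R v)
      = (p $ 3 + t * v $ 3) powr \<alpha> * ((p $ 1 + t * v $ 1) powr - \<alpha> + (p $ 2 + t * v $ 2) powr - \<alpha>)"
    using eventually_line_in_open[OF open_pos_octant p, of v]
    by eventually_elim (simp add: ratio_fun_eq)
  have "((\<lambda>t. (p $ 3 + t * v $ 3) powr \<alpha>
        * ((p $ 1 + t * v $ 1) powr - \<alpha> + (p $ 2 + t * v $ 2) powr - \<alpha>))
      has_real_derivative ratio_grad \<alpha> p \<bullet> v) (at 0)"
    by (rule derivative_eq_intros has_real_derivative_powr_line pos refl)+
      (simp add: ratio_grad_def inner_vec_def sum_3 algebra_simps)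
  then show ?thesis
    using DERIV_cong_ev[OF refl ev refl] by blast
qed

text \<open>The row vector stands on the left because the row index of \<open>hessian\<close> is the
  direction of the outer derivative.\<close>

lemma has_real_derivative_ratio_grad:
  assumes p: "p \<in> pos_octant"
  shows "((\<lambda>t. ratio_grad \<alpha> (p + t *\<^sub>R v) $ j) has_real_derivative (v v* ratio_hess \<alpha> p) $ j) (at 0)"
proof -
  have pos: "0 < p $ k" for k
    using p exhaust_3[of k] by (auto simp: pos_octant_def)
  have e: "- \<alpha> - 1 - 1 = - \<alpha> - 2" "\<alpha> - 1 - 1 = \<alpha> - 2" by auto
  consider "j = 1" | "j = 2" | "j = 3" using exhaust_3 by blast
  then show ?thesis
  proof cases
    case 1
    show ?thesis
      unfolding 1 ratio_grad_def vector_3 vector_add_component vector_scaleR_component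
        real_scaleR_def
      by (rule derivative_eq_intros has_real_derivative_powr_line pos refl)+
        (simp add: ratio_hess_def vector_matrix_mult_def sum_3 e power2_eq_square algebra_simps)
  next
    case 2
    show ?thesis
      unfolding 2 ratio_grad_def vector_3 vector_add_component vector_scaleR_component
        real_scaleR_def
      by (rule derivative_eq_intros has_real_derivative_powr_line pos refl)+
        (simp add: ratio_hess_def vector_matrix_mult_def sum_3 e power2_eq_square algebra_simps)
  next
    case 3
    show ?thesis
      unfolding 3 ratio_grad_def vector_3 vector_add_component vector_scaleR_component
        real_scaleR_def
      by (rule derivative_eq_intros has_real_derivative_powr_line pos refl)+
        (simp add: ratio_hess_def vector_matrix_mult_def sum_3 e power2_eq_square algebra_simps)
  qed
qed

section \<open>Hessian of the composition and its indefiniteness\<close>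

lemma has_real_derivative_comp_ratio_fun:
  assumes p: "p \<in> pos_octant" and G: "G differentiable (at (ratio_fun \<alpha> p))"
  shows "((\<lambda>t. G (ratio_fun \<alpha> (p + t *\<^sub>R v))) has_real_derivative
    deriv G (ratio_fun \<alpha> p) * (ratio_grad \<alpha> p \<bullet> v)) (at 0)"
proof -
  \<comment> \<open>The base point is written as the value of the line at 0, as the chain rule
    expects.\<close>
  have "(G has_real_derivative deriv G (ratio_fun \<alpha> p)) (at (ratio_fun \<alpha> (p + 0 *\<^sub>R v)))"
    using G by (simp add: DERIV_deriv_iff_real_differentiable)
  from DERIV_chain2[OF this has_real_derivative_ratio_fun[OF p]] show ?thesis .
qed

text \<open>The gradient is \<open>F'(u)\<close> times that of \<open>u\<close>; the product rule,
  with the chain rule applied to \<open>deriv F\<close>, gives a rank-one term plus a multiple of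
  the Hessian of \<open>u\<close>.\<close>

lemma hessian_comp_ratio_fun:
  assumes F: "twice_cont_differentiable F" and p: "p \<in> pos_octant"
  shows "hessian (\<lambda>q. F (ratio_fun \<alpha> q)) p $ i $ j
    = deriv (deriv F) (ratio_fun \<alpha> p) * ratio_grad \<alpha> p $ i * ratio_grad \<alpha> p $ j
      + deriv F (ratio_fun \<alpha> p) * ratio_hess \<alpha> p $ i $ j"
proof -
  have F1: "F differentiable (at t)" and F2: "deriv F differentiable (at t)" for t
    using F by (auto simp: twice_cont_differentiable_def)
  have part: "partial_deriv j (\<lambda>q. F (ratio_fun \<alpha> q)) q
      = deriv F (ratio_fun \<alpha> q) * ratio_grad \<alpha> q $ j" if "q \<in> pos_octant" for q
    unfolding partial_deriv_def
    using DERIV_imp_deriv[OF has_real_derivative_comp_ratio_fun[OF that F1, where v = "axis j 1"]]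
    by (simp add: inner_axis)
  have ev: "\<forall>\<^sub>F t in nhds 0. partial_deriv j (\<lambda>q. F (ratio_fun \<alpha> q)) (p + t *\<^sub>R axis i 1)
      = deriv F (ratio_fun \<alpha> (p + t *\<^sub>R axis i 1)) * ratio_grad \<alpha> (p + t *\<^sub>R axis i 1) $ j"
    using eventually_line_in_open[OF open_pos_octant p] by eventually_elim (rule part)
  have "hessian (\<lambda>q. F (ratio_fun \<alpha> q)) p $ i $ j
      = deriv (\<lambda>t. deriv F (ratio_fun \<alpha> (p + t *\<^sub>R axis i 1))
          * ratio_grad \<alpha> (p + t *\<^sub>R axis i 1) $ j) 0"
    \<comment> \<open>Only the outer partial, in direction \<open>i\<close>, is unfolded; the inner
      one must stay folded to match \<open>ev\<close>.\<close>
    unfolding hessian_def using deriv_cong_ev[OF ev refl] by (simp add: partial_deriv_def[of i])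
  also have "\<dots> = deriv (deriv F) (ratio_fun \<alpha> p) * ratio_grad \<alpha> p $ i * ratio_grad \<alpha> p $ j
      + deriv F (ratio_fun \<alpha> p) * ratio_hess \<alpha> p $ i $ j"
  proof (rule DERIV_imp_deriv)
    have axis: "(axis i 1 v* ratio_hess \<alpha> p) $ j = ratio_hess \<alpha> p $ i $ j"
      by (simp add: vector_matrix_mult_def axis_def if_distrib[of "\<lambda>x. x * _"] cong: if_cong)
    show "((\<lambda>t. deriv F (ratio_fun \<alpha> (p + t *\<^sub>R axis i 1))
          * ratio_grad \<alpha> (p + t *\<^sub>R axis i 1) $ j) has_real_derivative
        deriv (deriv F) (ratio_fun \<alpha> p) * ratio_grad \<alpha> p $ i * ratio_grad \<alpha> p $ j
          + deriv F (ratio_fun \<alpha> p) * ratio_hess \<alpha> p $ i $ j) (at 0)"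
      using DERIV_mult[OF has_real_derivative_comp_ratio_fun[OF p F2, where v = "axis i 1"]
          has_real_derivative_ratio_grad[OF p, of \<alpha> "axis i 1" j]]
      by (simp add: inner_axis axis algebra_simps)
  qed
  finally show ?thesis .
qed

text \<open>The test vector is \<open>p + s z e\<^sub>3\<close>; at \<open>s = 0\<close> the form vanishes to first order only.\<close>

lemma hessian_form_comp_ratio_fun:
  fixes \<alpha> :: real
  assumes F: "twice_cont_differentiable F" and p: "p \<in> pos_octant"
    and v: "v = vector [p $ 1, p $ 2, p $ 3 * (1 + s)]"
  defines "U \<equiv> ratio_fun \<alpha> p"
  shows "v \<bullet> (hessian (\<lambda>q. F (ratio_fun \<alpha> q)) p *v v)
    = s * (s * (deriv (deriv F) U * (\<alpha> * U)\<^sup>2 + deriv F U * \<alpha> * U * (\<alpha> - 1))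
        - 2 * (\<alpha> * U * deriv F U))"
proof -
  define x y z where xyz: "x = p $ 1" "y = p $ 2" "z = p $ 3"
  have pos: "0 < x" "0 < y" "0 < z"
    using p by (auto simp: pos_octant_def xyz)
  \<comment> \<open>With the powers named, the remaining identities are rational in the
    coordinates.\<close>
  define X Y Z where XYZ: "X = x powr - \<alpha>" "Y = y powr - \<alpha>" "Z = z powr \<alpha>"
  have powrs: "x powr (- \<alpha> - 1) = X / x" "y powr (- \<alpha> - 1) = Y / y" "z powr (\<alpha> - 1) = Z / z"
    "x powr (- \<alpha> - 2) = X / x\<^sup>2" "y powr (- \<alpha> - 2) = Y / y\<^sup>2" "z powr (\<alpha> - 2) = Z / z\<^sup>2"
    using pos by (simp_all add: XYZ powr_diff)
  have U: "U = Z * (X + Y)"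
    unfolding U_def using ratio_fun_eq[OF p] by (simp add: XYZ xyz)
  have grad: "ratio_grad \<alpha> p
      = vector [- \<alpha> * Z * (X / x), - \<alpha> * Z * (Y / y), \<alpha> * (Z / z) * (X + Y)]"
    unfolding ratio_grad_def xyz[symmetric] powrs XYZ[symmetric] ..
  have hess: "ratio_hess \<alpha> p = vector
     [vector [\<alpha> * (\<alpha> + 1) * Z * (X / x\<^sup>2), 0, - (\<alpha>\<^sup>2) * (Z / z) * (X / x)],
      vector [0, \<alpha> * (\<alpha> + 1) * Z * (Y / y\<^sup>2), - (\<alpha>\<^sup>2) * (Z / z) * (Y / y)],
      vector [- (\<alpha>\<^sup>2) * (Z / z) * (X / x), - (\<alpha>\<^sup>2) * (Z / z) * (Y / y),
        \<alpha> * (\<alpha> - 1) * (Z / z\<^sup>2) * (X + Y)]]"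
    unfolding ratio_hess_def xyz[symmetric] powrs XYZ[symmetric] ..
  have "v \<bullet> (hessian (\<lambda>q. F (ratio_fun \<alpha> q)) p *v v)
      = deriv (deriv F) U * (ratio_grad \<alpha> p \<bullet> v)\<^sup>2 + deriv F U * (v \<bullet> (ratio_hess \<alpha> p *v v))"
    by (simp add: inner_vec_def matrix_vector_mult_def sum_3
        hessian_comp_ratio_fun[OF F p] U_def power2_eq_square algebra_simps)
  \<comment> \<open>Euler's identity makes the gradient orthogonal to \<open>p\<close>; only the
    increment \<open>s * z\<close> in the third coordinate contributes.\<close>
  moreover have "ratio_grad \<alpha> p \<bullet> v = \<alpha> * U * s"
    unfolding grad v U xyz[symmetric] using pos
    by (simp add: inner_vec_def sum_3 field_simps)
  \<comment> \<open>The gradient has degree -1, so the Hessian of \<open>u\<close> sends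
    \<open>p\<close> to minus the gradient. Thus the pure \<open>p\<close> term vanishes, the mixed
    terms give \<open>- 2 * s\<close> and the third diagonal entry gives the square.\<close>
  moreover have "v \<bullet> (ratio_hess \<alpha> p *v v) = \<alpha> * U * ((\<alpha> - 1) * s\<^sup>2 - 2 * s)"
    unfolding hess v U xyz[symmetric] using pos
    by (simp add: inner_vec_def matrix_vector_mult_def sum_3 field_simps power2_eq_square)
  ultimately show ?thesis
    by (simp add: power2_eq_square algebra_simps)
qed

text \<open>The polynomial has a simple root at 0, with slope \<open>- b\<close>.\<close>

lemma quadratic_changes_sign:
  fixes a b :: real
  assumes "b \<noteq> 0"
  obtains s t where "0 < s * (s * a - b)" "t * (t * a - b) < 0"
proof -
  \<comment> \<open>At \<open>- d * b\<close> and \<open>d * b\<close> this size makes the linear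
    term dominate the quadratic one.\<close>
  define d where "d = 1 / (\<bar>a\<bar> + 1)"
  have d: "0 < d" "d * \<bar>a\<bar> < 1"
    by (auto simp: d_def)
  have sq: "0 < d * b\<^sup>2"
    using d assms by simp
  have bd: "\<bar>d * a\<bar> < 1"
    using d by (simp add: abs_mult)
  have "(d * b) * ((d * b) * a - b) = (d * b\<^sup>2) * (d * a - 1)"
    "(- d * b) * ((- d * b) * a - b) = (d * b\<^sup>2) * (d * a + 1)"
    by (simp_all add: power2_eq_square algebra_simps)
  moreover have "d * a - 1 < 0" "0 < d * a + 1"
    using bd by (auto simp: abs_less_iff)
  ultimately show thesis
    using that[of "- d * b" "d * b"] mult_pos_neg[OF sq] mult_pos_pos[OF sq] by metis
qed

lemma hessian_comp_ratio_fun_indefinite: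
  assumes "0 < \<alpha>" and F: "twice_cont_differentiable F" and p: "p \<in> pos_octant"
    and "deriv F (ratio_fun \<alpha> p) \<noteq> 0"
  shows "\<not> nonnegative_matrix (hessian (\<lambda>q. F (ratio_fun \<alpha> q)) p)"
    and "\<not> nonpositive_matrix (hessian (\<lambda>q. F (ratio_fun \<alpha> q)) p)"
proof -
  have "2 * (\<alpha> * ratio_fun \<alpha> p * deriv F (ratio_fun \<alpha> p)) \<noteq> 0"
    using assms ratio_fun_pos[OF p, of \<alpha>] by simp
  then obtain v w where
    "0 < v \<bullet> (hessian (\<lambda>q. F (ratio_fun \<alpha> q)) p *v v)"
    "w \<bullet> (hessian (\<lambda>q. F (ratio_fun \<alpha> q)) p *v w) < 0"
    \<comment> \<open>\<open>refl\<close> fixes the shape of the test vector and leaves its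
      parameter \<open>s\<close> free for the two signs.\<close>
    using hessian_form_comp_ratio_fun[OF F p refl] quadratic_changes_sign by metis
  then show "\<not> nonnegative_matrix (hessian (\<lambda>q. F (ratio_fun \<alpha> q)) p)"
    and "\<not> nonpositive_matrix (hessian (\<lambda>q. F (ratio_fun \<alpha> q)) p)"
    unfolding nonnegative_matrix_def nonpositive_matrix_def by (metis not_le)+
qed

section \<open>Failure of local convexity and concavity\<close>

text \<open>
  Compare \<open>f\<close> at \<open>r p\<close> (with \<open>r > 1\<close>) and at \<open>p + t v\<close> with its value at their midpoint.  By
  homogeneity the midpoint value is \<open>f (p + (t/(1+r)) v)\<close>, so midpoint convexity makes \<open>D t\<close> below
  minimal at \<open>t = 0\<close>, although \<open>D' 0 = d/2 - d/(1+r)\<close> is nonzero.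
\<close>

lemma not_convex_on_if_homogeneous:
  fixes f :: "'a::real_normed_vector \<Rightarrow> real"
  assumes p: "p \<in> interior N"
    and hom: "\<And>q r. q \<in> N \<Longrightarrow> 0 < r \<Longrightarrow> f (r *\<^sub>R q) = f q"
    and der: "((\<lambda>t. f (p + t *\<^sub>R v)) has_real_derivative d) (at 0)" and "d \<noteq> 0"
  shows "\<not> convex_on N f"
proof
  assume cvx: "convex_on N f"
  have "\<forall>\<^sub>F t::real in at_right 0. p + t *\<^sub>R p \<in> interior N"
    using eventually_line_in_open[OF open_interior p, of p]
    by (simp add: eventually_at_filter eventually_mono)
  then have "\<forall>\<^sub>F t::real in at_right 0. p + t *\<^sub>R p \<in> interior N \<and> 0 < t"
    using eventually_at_right_less by (rule eventually_conj)
  then obtain e :: real where e: "p + e *\<^sub>R p \<in> interior N" "0 < e"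
    using eventually_happens' trivial_limit_at_right_real by blast
  define r where "r = 1 + e"
  have r: "1 < r" "r *\<^sub>R p \<in> N"
    using e interior_subset by (auto simp: r_def scaleR_left_distrib)
  have pN: "p \<in> N"
    using p interior_subset by auto
  define D where "D t = (f p + f (p + t *\<^sub>R v)) / 2 - f (p + (t / (1 + r)) *\<^sub>R v)" for t
  have ev1: "\<forall>\<^sub>F t::real in nhds 0. p + t *\<^sub>R v \<in> N"
    using eventually_line_in_open[OF open_interior p]
    by eventually_elim (use interior_subset in auto)
  have ev2: "\<forall>\<^sub>F t::real in nhds 0. p + (t / (1 + r)) *\<^sub>R v \<in> N"
    using eventually_line_in_open[OF open_interior p, of "(1 / (1 + r)) *\<^sub>R v"]
    by eventually_elim (use interior_subset in auto)
  \<comment> \<open>Since \<open>D 0 = 0\<close> and \<open>f (r *\<^sub>R p) = f p\<close>, this is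
    midpoint convexity for \<open>r *\<^sub>R p\<close> and
    \<open>p + t *\<^sub>R v\<close>.\<close>
  have "\<forall>\<^sub>F t in nhds 0. D 0 \<le> D t"
    using ev1 ev2
  proof eventually_elim
    case (elim t)
    have "(1 - 1/2) *\<^sub>R (r *\<^sub>R p) + (1/2) *\<^sub>R (p + t *\<^sub>R v)
        = ((1 + r) / 2) *\<^sub>R (p + (t / (1 + r)) *\<^sub>R v)"
    proof -
      have "(1 + r) / 2 * (t / (1 + r)) = t / 2"
        using r by (simp add: field_simps)
      then have "((1 + r) / 2) *\<^sub>R (p + (t / (1 + r)) *\<^sub>R v)
          = ((1 + r) / 2) *\<^sub>R p + (t / 2) *\<^sub>R v"
        by (simp only: scaleR_right_distrib scaleR_scaleR)
      also have "\<dots> = (1 - 1/2) *\<^sub>R (r *\<^sub>R p) + (1/2) *\<^sub>R (p + t *\<^sub>R v)"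
        by (simp add: scaleR_right_distrib add_divide_distrib scaleR_left_distrib)
      finally show ?thesis by simp
    qed
    then have "f (((1 + r) / 2) *\<^sub>R (p + (t / (1 + r)) *\<^sub>R v))
        \<le> (1 - 1/2) * f (r *\<^sub>R p) + 1/2 * f (p + t *\<^sub>R v)"
      using convex_onD[OF cvx, of "1/2" "r *\<^sub>R p" "p + t *\<^sub>R v"] elim r by simp
    then show ?case
      using elim r pN by (simp add: hom D_def)
  qed
  then obtain \<delta> where \<delta>: "0 < \<delta>" "\<And>t. dist t 0 < \<delta> \<Longrightarrow> D 0 \<le> D t"
    unfolding eventually_nhds_metric by blast
  have der': "((\<lambda>t. f (p + (t / (1 + r)) *\<^sub>R v)) has_real_derivative d * (1 / (1 + r))) (at 0)"
    by (rule DERIV_chain2[where f = "\<lambda>t. f (p + t *\<^sub>R v)"])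
      (use der r in \<open>auto intro!: derivative_eq_intros\<close>)
  have "(D has_real_derivative d / 2 - d * (1 / (1 + r))) (at 0)"
    unfolding D_def by (rule DERIV_diff[OF _ der']) (auto intro!: derivative_eq_intros der)
  then have "d / 2 - d * (1 / (1 + r)) = 0"
    by (rule DERIV_local_min[OF _ \<delta>(1)]) (use \<delta>(2) in \<open>auto simp: dist_real_def\<close>)
  \<comment> \<open>\<open>r > 1\<close> gives 1/(1+r) < 1/2, so the slope cannot vanish.\<close>
  then show False
    using r \<open>d \<noteq> 0\<close> by (simp add: field_simps)
qed

lemma not_convex_on_comp_ratio_fun:
  assumes "0 < \<alpha>" and F: "F differentiable (at (ratio_fun \<alpha> p))"
    and nz: "deriv F (ratio_fun \<alpha> p) \<noteq> 0"
    and p: "p \<in> interior N" and N: "N \<subseteq> pos_octant"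
  shows "\<not> convex_on N (\<lambda>q. F (ratio_fun \<alpha> q))"
proof (rule not_convex_on_if_homogeneous[OF p])
  have pos: "p \<in> pos_octant"
    using p N interior_subset by blast
  show "((\<lambda>t. F (ratio_fun \<alpha> (p + t *\<^sub>R axis 3 1))) has_real_derivative
      deriv F (ratio_fun \<alpha> p) * (ratio_grad \<alpha> p \<bullet> axis 3 1)) (at 0)"
    by (rule has_real_derivative_comp_ratio_fun[OF pos F])
  \<comment> \<open>The function increases strictly in the third coordinate, so this direction has
    nonzero slope at every point.\<close>
  have "0 < ratio_grad \<alpha> p $ 3"
    using pos \<open>0 < \<alpha>\<close>
    by (auto simp: ratio_grad_def pos_octant_def intro!: mult_pos_pos add_pos_pos)
  then show "deriv F (ratio_fun \<alpha> p) * (ratio_grad \<alpha> p \<bullet> axis 3 1) \<noteq> 0"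
    using nz by (simp add: inner_axis)
qed (use N in \<open>auto simp: ratio_fun_scaleR\<close>)

text \<open>Replacing \<open>F\<close> by \<open>- F\<close> turns concavity into convexity and
  keeps the derivative nonzero.\<close>

lemma not_concave_on_comp_ratio_fun:
  assumes "0 < \<alpha>" and F: "F differentiable (at (ratio_fun \<alpha> p))"
    and nz: "deriv F (ratio_fun \<alpha> p) \<noteq> 0"
    and p: "p \<in> interior N" and N: "N \<subseteq> pos_octant"
  shows "\<not> concave_on N (\<lambda>q. F (ratio_fun \<alpha> q))"
proof -
  have "((\<lambda>t. - F t) has_real_derivative - deriv F (ratio_fun \<alpha> p)) (at (ratio_fun \<alpha> p))"
    using F by (intro DERIV_minus) (simp add: DERIV_deriv_iff_real_differentiable)
  then have "deriv (\<lambda>t. - F t) (ratio_fun \<alpha> p) \<noteq> 0"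
    using nz DERIV_imp_deriv by fastforce
  then show ?thesis
    unfolding concave_on_def using F
    by (intro not_convex_on_comp_ratio_fun[OF \<open>0 < \<alpha>\<close> _ _ p N]) auto
qed

theorem theorem1p1:
  fixes \<alpha> :: real
  assumes "0 < \<alpha>"
  shows "convex pos_octant \<and>
    quasi_convex_on pos_octant (ratio_fun \<alpha>) \<and>
    (\<alpha> \<le> 1 \<longrightarrow>
      (\<forall>p\<in>pos_octant. \<forall>F :: real \<Rightarrow> real.
         twice_cont_differentiable F \<and> deriv F (ratio_fun \<alpha> p) \<noteq> 0 \<longrightarrow>
           \<not> nonnegative_matrix (hessian (\<lambda>q. F (ratio_fun \<alpha> q)) p) \<and>
           \<not> nonpositive_matrix (hessian (\<lambda>q. F (ratio_fun \<alpha> q)) p))) \<and>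
    (\<alpha> \<le> 1 \<longrightarrow>
      (\<forall>F :: real \<Rightarrow> real.
         twice_cont_differentiable F \<and> ((\<forall>t. 0 < deriv F t) \<or> (\<forall>t. deriv F t < 0)) \<longrightarrow>
           (\<forall>p\<in>pos_octant. \<forall>N. p \<in> interior N \<and> N \<subseteq> pos_octant \<longrightarrow>
              \<not> convex_on N (\<lambda>q. F (ratio_fun \<alpha> q)) \<and>
              \<not> concave_on N (\<lambda>q. F (ratio_fun \<alpha> q)))))"
proof (intro conjI impI allI ballI; (elim conjE)?)
  show "convex pos_octant"
    by (rule convex_pos_octant)
  show "quasi_convex_on pos_octant (ratio_fun \<alpha>)"
    using assms by (simp add: quasi_convex_on_ratio_fun)
next
  fix p and F :: "real \<Rightarrow> real"
  assume "p \<in> pos_octant" "twice_cont_differentiable F" "deriv F (ratio_fun \<alpha> p) \<noteq> 0"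
  then show "\<not> nonnegative_matrix (hessian (\<lambda>q. F (ratio_fun \<alpha> q)) p)"
    and "\<not> nonpositive_matrix (hessian (\<lambda>q. F (ratio_fun \<alpha> q)) p)"
    using hessian_comp_ratio_fun_indefinite[OF assms] by blast+
next
  fix F :: "real \<Rightarrow> real" and p N
  assume F: "twice_cont_differentiable F" "(\<forall>t. 0 < deriv F t) \<or> (\<forall>t. deriv F t < 0)"
    and N: "p \<in> interior N" "N \<subseteq> pos_octant"
  have diff: "F differentiable (at (ratio_fun \<alpha> p))"
    using F(1) by (simp add: twice_cont_differentiable_def)
  have nz: "deriv F (ratio_fun \<alpha> p) \<noteq> 0"
    using F(2) by (metis less_irrefl)
  show "\<not> convex_on N (\<lambda>q. F (ratio_fun \<alpha> q))"
    by (rule not_convex_on_comp_ratio_fun[OF assms diff nz N])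
  show "\<not> concave_on N (\<lambda>q. F (ratio_fun \<alpha> q))"
    by (rule not_concave_on_comp_ratio_fun[OF assms diff nz N])
qed

end
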